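(* Let $k \ge 0$ be an integer and suppose $\mathcal{H}$ is a $(k+1)K_2$-minor-free clutter of rank $r$. Then $$|b(\mathcal{H})| \le \sum_{m=0}^{k\cdot(2r-3)2^{r-2}} \binom{|\mathcal{H}|}{m}\binom{r}{2}^m .$$
   Context: A set system is a finite set of finite subsets of the natural numbers $\mathbb{N}$. A clutter is a set system whose members are pairwise incomparable under inclusion. For a set system $\mathcal{H}$, its vertex set is $V(\mathcal{H}) = \bigcup_{S\in\mathcal{H}} S$, its rank is $\max_{S\in\mathcal{H}}|S|$, and $cl(\mathcal{H})$ is the clutter obtained from $\mathcal{H}$ by removing all members that are not inclusion-minimal. $|\mathcal{H}|$ is the number of sets in $\mathcal{H}$. A transversal of a clutter $\mathcal{H}$ is a set intersecting every $S\in\mathcal{H}$; a minimal transversal is a transversal not containing another transversal as a subset; the blocker $b(\mathcal{H})$ is the clutter consisting of all minimal transversals of $\mathcal{H}$, and $|b(\mathcal{H})|$ is the number of them. For a clutter $\mathcal{H}$ and $v\in\mathbb{N}$, the deletion of $v$ is $\mathcal{H}\backslash v = \{S\in\mathcal{H} : v\notin S\}$ and the contraction of $v$ is $\mathcal{H}/v = cl(\{S\setminus\{v\} : S\in\mathcal{H}\})$. A minor of $\mathcal{H}$ is a clutter obtained from $\mathcal{H}$ through a (possibly empty) series of deletions and contractions. $\mathcal{H}$ is $\mathcal{F}$-minor-free if $\mathcal{F}$ is not isomorphic to any minor of $\mathcal{H}$. $kK_2$ denotes the matching of size $k$, identified with its edge clutter, that is, the clutter consisting of $k$ pairwise disjoint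 sets of size $2$.
   Formalization: The upper summation limit is read as max(0, k(2r-3)2^(r-2)); this changes it only for rank r ≤ 1 with k ≥ 1, where the limit is negative and the claim with an empty sum fails, e.g. for {{0}}. The empty clutter is given rank 0. *)

theory Defs
  imports Complex_Main
begin

definition set_system :: "nat set set \<Rightarrow> bool" where
  "set_system H \<longleftrightarrow> finite H \<and> (\<forall>S\<in>H. finite S)"

definition clutter :: "nat set set \<Rightarrow> bool" where
  "clutter H \<longleftrightarrow> set_system H \<and> (\<forall>S\<in>H. \<forall>T\<in>H. S \<subseteq> T \<longrightarrow> S = T)"

definition vertex_set :: "nat set set \<Rightarrow> nat set" where
  "vertex_set H = \<Union>H"

(* The empty set system has no largest member; its rank is taken to be 0. *)
definition clutter_rank :: "nat set set \<Rightarrow> nat" where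
  "clutter_rank H = (if H = {} then 0 else Max (card ` H))"

definition cl :: "nat set set \<Rightarrow> nat set set" where
  "cl H = {S \<in> H. \<forall>T\<in>H. T \<subseteq> S \<longrightarrow> T = S}"

definition transversal :: "nat set set \<Rightarrow> nat set \<Rightarrow> bool" where
  "transversal H T \<longleftrightarrow> (\<forall>S\<in>H. T \<inter> S \<noteq> {})"

definition minimal_transversal :: "nat set set \<Rightarrow> nat set \<Rightarrow> bool" where
  "minimal_transversal H T \<longleftrightarrow>
     transversal H T \<and> (\<forall>T'. transversal H T' \<and> T' \<subseteq> T \<longrightarrow> T' = T)"

definition blocker :: "nat set set \<Rightarrow> nat set set" where
  "blocker H = {T. minimal_transversal H T}"

definition delete_vertex :: "nat set set \<Rightarrow> nat \<Rightarrow> nat set set" where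
  "delete_vertex H v = {S \<in> H. v \<notin> S}"

definition contract_vertex :: "nat set set \<Rightarrow> nat \<Rightarrow> nat set set" where
  "contract_vertex H v = cl ((\<lambda>S. S - {v}) ` H)"

(* clutter_minor H G means that G is a minor of H. *)
inductive clutter_minor :: "nat set set \<Rightarrow> nat set set \<Rightarrow> bool" for H where
  refl: "clutter_minor H H"
| deletion: "clutter_minor H G \<Longrightarrow> clutter_minor H (delete_vertex G v)"
| contraction: "clutter_minor H G \<Longrightarrow> clutter_minor H (contract_vertex G v)"

definition clutter_iso :: "nat set set \<Rightarrow> nat set set \<Rightarrow> bool" where
  "clutter_iso F G \<longleftrightarrow>
     (\<exists>f. bij_betw f (vertex_set F) (vertex_set G) \<and> (\<lambda>S. f ` S) ` F = G)"

definition minor_free :: "nat set set \<Rightarrow> nat set set \<Rightarrow> bool" where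
  "minor_free F H \<longleftrightarrow> \<not> (\<exists>G. clutter_minor H G \<and> clutter_iso F G)"

(* A fixed representative of the isomorphism class n K_2; it only ever enters
   through minor_free, which is invariant under isomorphism of its first argument. *)
definition matching :: "nat \<Rightarrow> nat set set" where
  "matching n = (\<lambda>i. {2 * i, 2 * i + 1}) ` {..<n}"

(* Pitfall: natural-number subtraction in k * (2 * r - 3) * 2 ^ (r - 2) truncates at 0.
   For r >= 2 this is the exact integer. For r <= 1 the expression is 0, that is, the
   maximum of 0 and the true value, which is not positive; so a sum over m from 0 up to
   this limit always contains its m = 0 term. With a negative limit (r <= 1, k >= 1)
   read as an empty sum, the bound on the number of minimal transversals would fail
   already for {{0}}. *)

end

theory Submission
  imports Defs "HOL-Library.FuncSet"
begin

text \<open>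
  The bound comes from encoding each minimal transversal of \<open>H\<close> injectively by a set
  of pairs \<open>(S, P)\<close>, where the edges \<open>S\<close> are distinct members of \<open>H\<close> and \<open>P\<close> is a
  two-element subset of \<open>S\<close>. Sets of \<open>m\<close> such pairs number at most
  \<open>(card H choose m) * (r choose 2) ^ m\<close>, so it is enough to bound the size of a code.
  
  The code is built vertex by vertex. Let \<open>T\<close> be a minimal transversal of \<open>F\<close> and \<open>v\<close> a
  vertex. Usually \<open>T - {v}\<close> is a minimal transversal of \<open>F\<close> with \<open>v\<close> deleted, and the
  construction goes on there. It fails to be one only if \<open>v\<close> is not in \<open>T\<close> and some \<open>u\<close> in
  \<open>T\<close> loses all its private edges, that is, all edges that meet \<open>T\<close> only in \<open>u\<close> contain
  \<open>v\<close>. Choose a private edge \<open>S\<close> of \<open>u\<close> and record \<open>(S, {u, v})\<close>. Now \<open>T - {u}\<close> hits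
  every edge except some that contain \<open>{u, v}\<close>, and it avoids \<open>S\<close>; so the edges containing
  \<open>{u, v}\<close> can be thrown away, \<open>S\<close> can be contracted, and the construction goes on with
  \<open>T - {u}\<close>. This is \<open>minimal_transversal_split\<close>, and iterating it gives
  \<open>blocker_certificate_injection\<close>.
  
  The codes obtained in this way (see \<open>certificate\<close>) have strong combinatorial
  properties: the pairs \<open>P\<close> are disjoint, an edge \<open>S\<close> contains no pair but its own, and every
  edge of \<open>H\<close> inside the union of the recorded edges contains some recorded pair. The last
  property holds because the part of \<open>T\<close> that remains at the end avoids the recorded edges but
  hits every edge that was neither thrown away nor lost in a deletion; an edge lost in a deletion
  has a vertex outside all recorded edges.
  
  A long code therefore yields a large matching minor. From each pair choose one vertex, to be
  contracted, at random; the other is to be deleted. Since an edge \<open>S\<close> has at most \<open>r - 2\<close>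
  vertices outside its own pair, with probability at least \<open>1 / 2 ^ (r - 2)\<close> all those that
  lie in other pairs are chosen (\<open>ex_subset_agreeing_with_many\<close>). Among the edges for which
  this happens, being hit by another pair defines a digraph of out-degree at most \<open>r - 2\<close>, and
  so a fraction \<open>1 / (2 * r - 3)\<close> of them is independent (\<open>ex_independent_set\<close>). Keeping the
  pairs of these edges intact, contracting the chosen vertices of the other pairs and all
  vertices of recorded edges outside the pairs, and deleting the rest, turns the edges kept into their pairs; any
  other edge that survives contains a recorded pair, which must be one of those kept. What
  remains is a matching (\<open>large_certificate_gives_matching_minor\<close>).
\<close>

section \<open>Certificates of minimal transversals\<close>

lemma minimal_transversal_iff_private_edges:
  "minimal_transversal F T \<longleftrightarrow> transversal F T \<and> (\<forall>u\<in>T. \<exists>S\<in>F. S \<inter> T = {u})"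
proof
  assume min: "minimal_transversal F T"
  then have tr: "transversal F T" by (simp add: minimal_transversal_def)
  have "\<exists>S\<in>F. S \<inter> T = {u}" if u: "u \<in> T" for u
  proof -
    have "\<not> transversal F (T - {u})"
      using min u unfolding minimal_transversal_def by blast
    then obtain S where "S \<in> F" "(T - {u}) \<inter> S = {}"
      unfolding transversal_def by blast
    moreover have "T \<inter> S \<noteq> {}" using tr \<open>S \<in> F\<close> by (simp add: transversal_def)
    ultimately show ?thesis by blast
  qed
  then show "transversal F T \<and> (\<forall>u\<in>T. \<exists>S\<in>F. S \<inter> T = {u})" using tr by blast
next
  assume R: "transversal F T \<and> (\<forall>u\<in>T. \<exists>S\<in>F. S \<inter> T = {u})"
  have "T' = T" if T': "transversal F T'" "T' \<subseteq> T" for T'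
  proof (rule ccontr)
    assume "T' \<noteq> T"
    then obtain u where u: "u \<in> T" "u \<notin> T'" using T' by blast
    then obtain S where "S \<in> F" "S \<inter> T = {u}" using R by blast
    moreover from this have "T' \<inter> S \<noteq> {}" using T'(1) by (simp add: transversal_def)
    ultimately show False using T'(2) u(2) by auto
  qed
  then show "minimal_transversal F T" using R unfolding minimal_transversal_def by blast
qed

text \<open>
  Here \<open>F\<close> is the family of edges still in play and \<open>X\<close> the set of vertices contracted so
  far. Edges are kept in their original form instead of being replaced by their traces outside
  \<open>X\<close>, so that the recorded edges are members of the original clutter; a minimal transversal
  of the traces is the same as a minimal transversal of \<open>F\<close> that avoids \<open>X\<close>. The premise of
  the rule \<open>empty\<close> is what the existence of any transversal avoiding \<open>X\<close> entails. A
  certificate is a set and not a list: forgetting the order is what makes the final count one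
  of subsets of the clutter.
\<close>

inductive certificate ::
  "nat set set \<Rightarrow> nat set \<Rightarrow> (nat set \<times> nat set) set \<Rightarrow> bool" where
  empty: "(\<And>R. R \<in> F \<Longrightarrow> \<not> R \<subseteq> X) \<Longrightarrow> certificate F X {}"
| step: "S \<in> F \<Longrightarrow> P \<subseteq> S \<Longrightarrow> P \<inter> X = {} \<Longrightarrow> card P = 2 \<Longrightarrow>
    certificate {R \<in> F. \<not> P \<subseteq> R} (X \<union> S) M \<Longrightarrow> certificate F X (insert (S, P) M)"

text \<open>
  Deleted vertices leave no trace in a certificate: later edges avoid \<open>v\<close>, so it never enters
  \<open>X\<close>, and an edge through \<open>v\<close> cannot end up inside the recorded edges.
\<close>

lemma certificate_undelete:
  assumes "certificate (delete_vertex F v) X M" "v \<notin> X"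
  shows "certificate F X M"
proof -
  have "certificate F X M" if "certificate G X M" "G = delete_vertex F v" "v \<notin> X" for G F X M
    using that
  proof (induction arbitrary: F rule: certificate.induct)
    case (empty G X)
    show ?case
      by (rule certificate.empty) (use empty in \<open>auto simp: delete_vertex_def\<close>)
  next
    case (step S G P X M)
    have S: "S \<in> F" "v \<notin> S" using step by (auto simp: delete_vertex_def)
    have eq: "{R \<in> G. \<not> P \<subseteq> R} = delete_vertex {R \<in> F. \<not> P \<subseteq> R} v"
      using step by (auto simp: delete_vertex_def)
    have "certificate {R \<in> F. \<not> P \<subseteq> R} (X \<union> S) M"
      by (rule step.IH[OF eq]) (use S step.prems in auto)
    then show ?case using certificate.step S step.hyps by blast
  qed
  then show ?thesis using assms by blast
qed

lemma certificate_pair: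
  assumes "certificate F X M" "(S, P) \<in> M"
  shows "S \<in> F \<and> P \<subseteq> S \<and> P \<inter> X = {} \<and> card P = 2"
  using assms
proof (induction rule: certificate.induct)
  case (step S0 F P0 X M)
  show ?case
  proof (cases "(S, P) = (S0, P0)")
    case True
    then show ?thesis using step.hyps by simp
  next
    case False
    then have "(S, P) \<in> M" using step.prems by blast
    then show ?thesis using step.IH by blast
  qed
qed simp

text \<open>
  After \<open>(S, P)\<close> is recorded, all later pairs avoid \<open>S\<close>, which gives the first two
  properties, and no later edge contains \<open>P\<close>, which gives the third. The conclusion is
  symmetric and makes no reference to the order of recording.
\<close>

lemma certificate_disjoint_pairs:
  assumes "certificate F X M" "(S, P) \<in> M" "(S', P') \<in> M" "(S, P) \<noteq> (S', P')"
  shows "P \<inter> P' = {} \<and> \<not> P' \<subseteq> S \<and> \<not> P \<subseteq> S'"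
  using assms
proof (induction arbitrary: S P S' P' rule: certificate.induct)
  case (step S0 F P0 X M)
  have new: "P0 \<inter> P = {} \<and> \<not> P \<subseteq> S0 \<and> \<not> P0 \<subseteq> S" if "(S, P) \<in> M" for S P
  proof -
    have *: "P \<inter> (X \<union> S0) = {}" "S \<in> {R \<in> F. \<not> P0 \<subseteq> R}" "card P = 2"
      using certificate_pair[OF step.hyps(5) that] by auto
    then have "P \<noteq> {}" by auto
    then show ?thesis using * step.hyps by blast
  qed
  show ?case using step.prems step.IH[of S P S' P'] new[of S P] new[of S' P'] by auto
qed simp

text \<open>
  An edge that is never discarded for containing a recorded pair survives to the rule \<open>empty\<close>,
  which forbids it to lie inside the contracted set.
\<close>

lemma certificate_covers:
  assumes "certificate F X M" "R \<in> F" "R \<subseteq> X \<union> \<Union>(fst ` M)"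
  shows "\<exists>P\<in>snd ` M. P \<subseteq> R"
  using assms
proof (induction arbitrary: R rule: certificate.induct)
  case (step S F P X M)
  show ?case
  proof (cases "P \<subseteq> R")
    case True
    then show ?thesis by simp
  next
    case False
    then have "\<exists>P\<in>snd ` M. P \<subseteq> R" using step.IH[of R] step.prems by (simp add: Un_assoc)
    then show ?thesis by simp
  qed
qed simp

text \<open>
  If \<open>T - {v}\<close> stops being a minimal transversal when \<open>v\<close> is deleted, then some \<open>u\<close> in
  \<open>T\<close> has lost all its private edges, so each of them contains \<open>v\<close>. Hence the edges missed by
  \<open>T - {u}\<close> all contain \<open>{u, v}\<close>. The other elements of \<open>T\<close> keep their private edges, because
  those do not contain \<open>u\<close>.
\<close>

lemma minimal_transversal_split:
  assumes min: "minimal_transversal F T" and "T \<inter> X = {}" "v \<notin> X"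
    and not: "\<not> minimal_transversal (delete_vertex F v) (T - {v})"
  obtains S u where "S \<in> F" "v \<in> S" "u \<in> S" "u \<noteq> v" "u \<notin> X" "u \<in> T"
    "minimal_transversal {R \<in> F. \<not> {u, v} \<subseteq> R} (T - {u})" "(T - {u}) \<inter> (X \<union> S) = {}"
proof -
  have tr: "transversal F T" and priv: "\<And>u. u \<in> T \<Longrightarrow> \<exists>S\<in>F. S \<inter> T = {u}"
    using min by (auto simp: minimal_transversal_iff_private_edges)
  have "transversal (delete_vertex F v) (T - {v})"
    using tr by (fastforce simp: transversal_def delete_vertex_def)
  then obtain u where u: "u \<in> T" "u \<noteq> v"
    and nopriv: "\<And>R. R \<in> F \<Longrightarrow> v \<notin> R \<Longrightarrow> R \<inter> (T - {v}) \<noteq> {u}"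
    using not by (auto simp: minimal_transversal_iff_private_edges delete_vertex_def)
  obtain S where S: "S \<in> F" "S \<inter> T = {u}" using priv u by blast
  have vS: "v \<in> S" using nopriv[OF S(1)] S(2) u(2) by blast
  have "v \<notin> T" using vS S(2) u(2) by auto
  have both: "{u, v} \<subseteq> R" if "R \<in> F" "R \<inter> (T - {u}) = {}" for R
  proof -
    have "R \<inter> T = {u}" using tr that by (fastforce simp: transversal_def)
    then show ?thesis using nopriv[OF that(1)] \<open>v \<notin> T\<close> by auto
  qed
  have "minimal_transversal {R \<in> F. \<not> {u, v} \<subseteq> R} (T - {u})"
    unfolding minimal_transversal_iff_private_edges
  proof (intro conjI ballI)
    show "transversal {R \<in> F. \<not> {u, v} \<subseteq> R} (T - {u})"
      unfolding transversal_def using both by blast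
    fix w assume w: "w \<in> T - {u}"
    then obtain R where "R \<in> F" "R \<inter> T = {w}" using priv by blast
    then show "\<exists>R\<in>{R \<in> F. \<not> {u, v} \<subseteq> R}. R \<inter> (T - {u}) = {w}"
      using w u by (intro bexI[of _ R]) auto
  qed
  moreover have "u \<in> S" "u \<notin> X" "(T - {u}) \<inter> (X \<union> S) = {}" using S u assms(2) by auto
  ultimately show thesis using that S(1) vS u by blast
qed

text \<open>
  The induction fixes one vertex \<open>v\<close> and applies the dichotomy of
  \<open>minimal_transversal_split\<close> to every \<open>T\<close>. Injectivity holds because a certificate shows
  which case produced it: in the deletion case no recorded pair contains \<open>v\<close>, and otherwise
  exactly one does, the one just added. From that entry \<open>S\<close> and \<open>u\<close> can be read off, and thus
  the subproblem to which the rest of the certificate belongs.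
\<close>

lemma blocker_certificate_injection:
  assumes "set_system F"
  shows "\<exists>f. inj_on f {T \<in> blocker F. T \<inter> X = {}} \<and>
    f ` {T \<in> blocker F. T \<inter> X = {}} \<subseteq> {M. certificate F X M}"
  using assms
proof (induction "card (\<Union>F - X)" arbitrary: F X rule: less_induct)
  case less
  define B where "B G Y = {T \<in> blocker G. T \<inter> Y = {}}" for G Y
  have "finite F" "\<forall>S\<in>F. finite S" using less.prems unfolding set_system_def by blast+
  then have fin: "finite (\<Union>F - X)" by simp
  show ?case
  proof (cases "\<Union>F \<subseteq> X")
    case True
    have "T = {} \<and> certificate F X {}" if "T \<in> B F X" for T
    proof -
      have T: "minimal_transversal F T" "T \<inter> X = {}" using that by (auto simp: B_def blocker_def)
      then have "F = {}" using True
        by (fastforce simp: minimal_transversal_def transversal_def)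
      then show ?thesis using T
        by (auto simp: minimal_transversal_iff_private_edges intro: certificate.empty)
    qed
    then have "inj_on (\<lambda>T. {}) (B F X) \<and> (\<lambda>T. {}) ` B F X \<subseteq> {M. certificate F X M}"
      by (auto simp: inj_on_def)
    then show ?thesis unfolding B_def by blast
  next
    case False
    then obtain v where v: "v \<in> \<Union>F" "v \<notin> X" by blast
    define Del where "Del = delete_vertex F v"
    define Avoid where "Avoid u = {R \<in> F. \<not> {u, v} \<subseteq> R}" for u
    have "\<Union>Del - X \<subset> \<Union>F - X" using v by (auto simp: Del_def delete_vertex_def)
    then have "card (\<Union>Del - X) < card (\<Union>F - X)" using fin by (intro psubset_card_mono)
    moreover have "set_system Del"
      using less.prems by (auto simp: set_system_def Del_def delete_vertex_def)
    ultimately obtain f where f: "inj_on f (B Del X)" "f ` B Del X \<subseteq> {M. certificate Del X M}"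
      unfolding B_def using less.hyps by blast
    have "\<exists>g. inj_on g (B (Avoid u) (X \<union> S)) \<and>
        g ` B (Avoid u) (X \<union> S) \<subseteq> {M. certificate (Avoid u) (X \<union> S) M}"
      if "v \<in> S" for S u
    proof -
      have "\<Union>(Avoid u) - (X \<union> S) \<subset> \<Union>F - X" using v that by (auto simp: Avoid_def)
      then have "card (\<Union>(Avoid u) - (X \<union> S)) < card (\<Union>F - X)"
        using fin by (intro psubset_card_mono)
      moreover have "set_system (Avoid u)" using less.prems by (auto simp: set_system_def Avoid_def)
      ultimately show ?thesis unfolding B_def using less.hyps by blast
    qed
    then obtain g where g: "\<And>S u. v \<in> S \<Longrightarrow> inj_on (g S u) (B (Avoid u) (X \<union> S))"
      "\<And>S u. v \<in> S \<Longrightarrow>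
        g S u ` B (Avoid u) (X \<union> S) \<subseteq> {M. certificate (Avoid u) (X \<union> S) M}"
      by metis
    \<comment> \<open>\<open>Q\<close> holds in the deletion case; \<open>p T\<close> is the edge \<open>S\<close> and vertex \<open>u\<close> of the other case.\<close>
    define Q where "Q T = (minimal_transversal Del (T - {v}))" for T
    have "\<exists>p. fst p \<in> F \<and> v \<in> fst p \<and> snd p \<in> fst p \<and> snd p \<noteq> v \<and> snd p \<notin> X \<and> snd p \<in> T \<and>
        T - {snd p} \<in> B (Avoid (snd p)) (X \<union> fst p)"
      if T: "T \<in> B F X" "\<not> Q T" for T
    proof -
      have minT: "minimal_transversal F T" and TX: "T \<inter> X = {}"
        using T by (auto simp: B_def blocker_def)
      have "\<not> minimal_transversal (delete_vertex F v) (T - {v})"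
        using T(2) by (simp add: Q_def Del_def)
      from minT TX v(2) this obtain S u where Su: "S \<in> F" "v \<in> S" "u \<in> S" "u \<noteq> v" "u \<notin> X" "u \<in> T"
        and "minimal_transversal {R \<in> F. \<not> {u, v} \<subseteq> R} (T - {u})" "(T - {u}) \<inter> (X \<union> S) = {}"
        by (rule minimal_transversal_split)
      then have "T - {u} \<in> B (Avoid u) (X \<union> S)" by (simp add: Avoid_def B_def blocker_def)
      with Su show ?thesis by (intro exI[of _ "(S, u)"]) simp
    qed
    then obtain p where p: "\<And>T. T \<in> B F X \<Longrightarrow> \<not> Q T \<Longrightarrow>
        fst (p T) \<in> F \<and> v \<in> fst (p T) \<and> snd (p T) \<in> fst (p T) \<and> snd (p T) \<noteq> v \<and>
        snd (p T) \<notin> X \<and> snd (p T) \<in> T \<and>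
        T - {snd (p T)} \<in> B (Avoid (snd (p T))) (X \<union> fst (p T))"
      by metis
    define N where "N T = g (fst (p T)) (snd (p T)) (T - {snd (p T)})" for T
    define h where
      "h T = (if Q T then f (T - {v}) else insert (fst (p T), {snd (p T), v}) (N T))" for T
    have fT: "T - {v} \<in> B Del X" if "T \<in> B F X" "Q T" for T
      using that by (auto simp: B_def blocker_def Q_def)
    have cN: "certificate (Avoid (snd (p T))) (X \<union> fst (p T)) (N T)"
      if "T \<in> B F X" "\<not> Q T" for T
      using p[OF that] g(2)[of "fst (p T)" "snd (p T)"] unfolding N_def by blast
    have cf: "certificate Del X (f (T - {v}))" if "T \<in> B F X" "Q T" for T
      using fT[OF that] f(2) by blast
    have cert: "certificate F X (h T)" if T: "T \<in> B F X" for T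
    proof (cases "Q T")
      case True
      then show ?thesis using cf[OF T True] v(2) certificate_undelete
        by (simp add: h_def Del_def)
    next
      case False
      show ?thesis unfolding h_def if_not_P[OF False]
        by (rule certificate.step) (use p[OF T False] cN[OF T False] v(2) in
          \<open>auto simp: Avoid_def card_2_iff\<close>)
    qed
    have vN: "v \<notin> P" if "T \<in> B F X" "\<not> Q T" "(S, P) \<in> N T" for T S P
      using certificate_pair[OF cN[OF that(1,2)] that(3)] p[OF that(1,2)] by blast
    have vf: "v \<notin> P" if "T \<in> B F X" "Q T" "(S, P) \<in> f (T - {v})" for T S P
      using certificate_pair[OF cf[OF that(1,2)] that(3)]
      by (auto simp: Del_def delete_vertex_def)
    have "inj_on h (B F X)"
    proof (rule inj_onI)
      fix T T' assume T: "T \<in> B F X" and T': "T' \<in> B F X" and eq: "h T = h T'"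
      have minT: "minimal_transversal F T" "minimal_transversal F T'"
        using T T' by (auto simp: B_def blocker_def)
      have Qiff: "Q U \<longleftrightarrow> (\<forall>(S, P)\<in>h U. v \<notin> P)" if "U \<in> B F X" for U
        using vf[OF that] by (auto simp: h_def)
      show "T = T'"
      proof (cases "Q T")
        case True
        then have Q': "Q T'" using Qiff[OF T] Qiff[OF T'] eq by simp
        have "T - {v} = T' - {v}"
          using eq True Q' fT[OF T True] fT[OF T' Q'] f(1) by (auto simp: h_def inj_on_def)
        \<comment> \<open>\<open>T\<close> and \<open>T'\<close> differ at most in \<open>v\<close>, and minimal transversals are incomparable.\<close>
        then have "T \<subseteq> T' \<or> T' \<subseteq> T" by blast
        then show ?thesis using minT unfolding minimal_transversal_def by metis
      next
        case False
        then have Q': "\<not> Q T'" using Qiff[OF T] Qiff[OF T'] eq by simp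
        define x y where "x = (fst (p T), {snd (p T), v})" and "y = (fst (p T'), {snd (p T'), v})"
        have eq': "insert x (N T) = insert y (N T')" using eq False Q' by (simp add: h_def x_def y_def)
        have x: "x \<notin> N T'" "x \<notin> N T" using vN[OF T' Q'] vN[OF T False] unfolding x_def by blast+
        have y: "y \<notin> N T" "y \<notin> N T'" using vN[OF T False] vN[OF T' Q'] unfolding y_def by blast+
        have "x = y" using eq' x(1) by (metis insertE insertI1)
        then have NN: "N T = N T'" using eq' x(2) y(2) by (metis insert_ident)
        have "(fst (p T), {snd (p T), v}) = (fst (p T'), {snd (p T'), v})"
          using \<open>x = y\<close> unfolding x_def y_def .
        then have pp: "fst (p T) = fst (p T')" "snd (p T) = snd (p T')"
          using p[OF T False] p[OF T' Q'] by (auto simp: doubleton_eq_iff)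
        have "T - {snd (p T)} = T' - {snd (p T)}"
        proof (rule inj_onD)
          show "inj_on (g (fst (p T)) (snd (p T))) (B (Avoid (snd (p T))) (X \<union> fst (p T)))"
            using g(1) p[OF T False] by blast
        qed (use NN p[OF T False] p[OF T' Q'] pp in \<open>simp_all add: N_def\<close>)
        moreover have "snd (p T) \<in> T" "snd (p T) \<in> T'" using p[OF T False] p[OF T' Q'] pp(2) by simp_all
        ultimately show ?thesis by (metis insert_Diff)
      qed
    qed
    moreover have "h ` B F X \<subseteq> {M. certificate F X M}" using cert by blast
    ultimately show ?thesis unfolding B_def by blast
  qed
qed

section \<open>Two averaging arguments\<close>

text \<open>
  A uniformly random subset of \<open>J\<close> has a prescribed trace on a given set of size at most \<open>d\<close>
  with probability at least \<open>1 / 2 ^ d\<close>; some subset does at least as well as the average.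
\<close>

lemma ex_subset_agreeing_with_many:
  fixes N Y :: "'i \<Rightarrow> 'j set"
  assumes "finite I" "finite J"
    and N: "\<And>i. i \<in> I \<Longrightarrow> N i \<subseteq> J" "\<And>i. i \<in> I \<Longrightarrow> card (N i) \<le> d"
    and Y: "\<And>i. i \<in> I \<Longrightarrow> Y i \<subseteq> N i"
  shows "\<exists>Z\<subseteq>J. card I \<le> 2 ^ d * card {i \<in> I. Z \<inter> N i = Y i}"
proof (rule ccontr)
  assume "\<not> ?thesis"
  then have "\<And>Z. Z \<in> Pow J \<Longrightarrow> 2 ^ d * card {i \<in> I. Z \<inter> N i = Y i} < card I"
    by (meson PowD not_le)
  then have "(\<Sum>Z\<in>Pow J. 2 ^ d * card {i \<in> I. Z \<inter> N i = Y i}) < (\<Sum>Z\<in>Pow J. card I)"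
    using \<open>finite J\<close> by (intro sum_strict_mono) auto
  also have "\<dots> = 2 ^ card J * card I" using \<open>finite J\<close> by (simp add: card_Pow)
  finally have less: "2 ^ d * (\<Sum>Z\<in>Pow J. card {i \<in> I. Z \<inter> N i = Y i}) < 2 ^ card J * card I"
    by (simp add: sum_distrib_left)
  have "2 ^ card J \<le> 2 ^ d * card {Z \<in> Pow J. Z \<inter> N i = Y i}" if i: "i \<in> I" for i
  proof -
    have "(\<union>) (Y i) ` Pow (J - N i) \<subseteq> {Z \<in> Pow J. Z \<inter> N i = Y i}"
      using N(1)[OF i] Y[OF i] by blast
    moreover have "inj_on ((\<union>) (Y i)) (Pow (J - N i))"
      using Y[OF i] by (auto simp: inj_on_def)
    ultimately have "card (Pow (J - N i)) \<le> card {Z \<in> Pow J. Z \<inter> N i = Y i}"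
      using \<open>finite J\<close> by (intro card_inj_on_le) auto
    moreover have "card (Pow (J - N i)) = 2 ^ (card J - card (N i))"
      using \<open>finite J\<close> N(1)[OF i] by (simp add: card_Pow card_Diff_subset finite_subset)
    moreover have "(2::nat) ^ card J \<le> 2 ^ (d + (card J - card (N i)))"
      using N(2)[OF i] by (intro power_increasing) auto
    ultimately show ?thesis
      by (metis (no_types, lifting) mult_le_mono2 order_trans power_add)
  qed
  then have "(\<Sum>i\<in>I. 2 ^ card J) \<le> (\<Sum>i\<in>I. 2 ^ d * card {Z \<in> Pow J. Z \<inter> N i = Y i})"
    by (rule sum_mono)
  also have "\<dots> = 2 ^ d * (\<Sum>i\<in>I. card {Z \<in> Pow J. Z \<inter> N i = Y i})"
    by (simp add: sum_distrib_left)
  also have "(\<Sum>i\<in>I. card {Z \<in> Pow J. Z \<inter> N i = Y i}) =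
      (\<Sum>Z\<in>Pow J. card {i \<in> I. Z \<inter> N i = Y i})"
    using assms(1,2) by (intro sum_multicount_gen[symmetric]) auto
  finally show False using less by (simp add: mult.commute)
qed

text \<open>
  The total number of arcs is at most \<open>d\<close> times the number of vertices, so some vertex has
  in-degree at most \<open>d\<close> and hence at most \<open>2 * d\<close> neighbours. Put it into the independent set,
  remove it together with its neighbours, and repeat.
\<close>

lemma ex_independent_set:
  fixes A :: "('i \<times> 'i) set"
  assumes "finite I" and "\<And>i. i \<in> I \<Longrightarrow> card {j \<in> I. (i, j) \<in> A} \<le> d"
  shows "\<exists>J\<subseteq>I. card I \<le> (2 * d + 1) * card J \<and> (\<forall>i\<in>J. \<forall>j\<in>J. i \<noteq> j \<longrightarrow> (i, j) \<notin> A)"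
  using assms
proof (induction "card I" arbitrary: I rule: less_induct)
  case less
  show ?case
  proof (cases "I = {}")
    case False
    let ?out = "\<lambda>i. {j \<in> I. (i, j) \<in> A}" and ?in = "\<lambda>i. {j \<in> I. (j, i) \<in> A}"
    have "(\<Sum>i\<in>I. card (?in i)) = (\<Sum>i\<in>I. card (?out i))"
      using less.prems(1) by (intro sum_multicount_gen) auto
    also have "\<dots> \<le> (\<Sum>i\<in>I. d)" using less.prems(2) by (rule sum_mono)
    finally have "(\<Sum>i\<in>I. card (?in i)) \<le> (\<Sum>i\<in>I. d)" .
    moreover have "(\<Sum>i\<in>I. d) < (\<Sum>i\<in>I. card (?in i))" if "\<And>i. i \<in> I \<Longrightarrow> d < card (?in i)"
      using less.prems(1) False that by (rule sum_strict_mono)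
    ultimately obtain i where i: "i \<in> I" "card (?in i) \<le> d"
      by (meson leD leI)
    let ?N = "insert i (?in i \<union> ?out i)"
    have NI: "?N \<subseteq> I" using i by auto
    have "card ?N \<le> Suc (card (?in i \<union> ?out i))" by (rule card_insert_le_m1) auto
    also have "card (?in i \<union> ?out i) \<le> 2 * d"
      using card_Un_le[of "?in i" "?out i"] i less.prems(2)[of i] by linarith
    finally have cN: "card ?N \<le> 2 * d + 1" by simp
    have "card (I - ?N) < card I" using i less.prems(1) by (intro psubset_card_mono) auto
    moreover have "card {j \<in> I - ?N. (l, j) \<in> A} \<le> d" if "l \<in> I - ?N" for l
    proof -
      have "card {j \<in> I - ?N. (l, j) \<in> A} \<le> card (?out l)"
        using less.prems(1) by (intro card_mono) auto
      then show ?thesis using less.prems(2)[of l] that by auto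
    qed
    ultimately obtain J where J: "J \<subseteq> I - ?N" "card (I - ?N) \<le> (2 * d + 1) * card J"
      "\<forall>i\<in>J. \<forall>j\<in>J. i \<noteq> j \<longrightarrow> (i, j) \<notin> A"
      using less.hyps[of "I - ?N"] less.prems(1) by auto
    have "finite J" using J(1) less.prems(1) by (meson finite_Diff finite_subset)
    moreover have "i \<notin> J" using J(1) by blast
    ultimately have cJ: "card (insert i J) = Suc (card J)" by simp
    have "card I = card (I - ?N) + card ?N"
      using NI less.prems(1) by (metis (no_types, lifting) card_Diff_subset card_mono
        finite_subset le_add_diff_inverse2)
    then have "card I \<le> (2 * d + 1) * card (insert i J)" unfolding cJ using J(2) cN by simp
    moreover have "\<forall>a\<in>insert i J. \<forall>b\<in>insert i J. a \<noteq> b \<longrightarrow> (a, b) \<notin> A"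
      using J by blast
    moreover have "insert i J \<subseteq> I" using J(1) i by auto
    ultimately show ?thesis by blast
  qed auto
qed

section \<open>Minors of clutters\<close>

lemma ex_cl_subset:
  assumes "finite H" "S \<in> H"
  shows "\<exists>T\<in>cl H. T \<subseteq> S"
  using finite_has_minimal2[OF assms] by (auto simp: cl_def)

lemma cl_clutter: "clutter H \<Longrightarrow> cl H = H"
  by (auto simp: cl_def clutter_def)

lemma cl_eqI:
  assumes "K \<subseteq> G" "\<And>S. S \<in> G \<Longrightarrow> \<exists>T\<in>K. T \<subseteq> S" "\<And>S T. S \<in> K \<Longrightarrow> T \<in> K \<Longrightarrow> S \<subseteq> T \<Longrightarrow> S = T"
  shows "cl G = K"
proof
  show "cl G \<subseteq> K"
  proof
    fix S assume S: "S \<in> cl G"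
    then obtain T where T: "T \<in> K" "T \<subseteq> S" using assms(2)[of S] by (auto simp: cl_def)
    then have "T = S" using S assms(1) by (auto simp: cl_def)
    then show "S \<in> K" using T by simp
  qed
  show "K \<subseteq> cl G"
  proof
    fix S assume S: "S \<in> K"
    have "T = S" if T: "T \<in> G" "T \<subseteq> S" for T
    proof -
      obtain U where "U \<in> K" "U \<subseteq> T" using assms(2) T(1) by blast
      then show ?thesis using assms(3)[of U S] S T by blast
    qed
    then show "S \<in> cl G" using S assms(1) by (auto simp: cl_def)
  qed
qed

text \<open>
  Discarding non-minimal sets may be postponed: this merges a series of contractions, each
  followed by \<open>cl\<close>, into one.
\<close>

lemma cl_image_cl:
  assumes "finite G" "\<And>S T. S \<subseteq> T \<Longrightarrow> f S \<subseteq> f T"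
  shows "cl (f ` cl G) = cl (f ` G)"
proof (rule cl_eqI)
  have below: "\<exists>T\<in>cl (f ` G). T \<subseteq> U" if "U \<in> f ` G" for U
    using ex_cl_subset[of "f ` G"] assms(1) that by blast
  show "cl (f ` G) \<subseteq> f ` cl G"
  proof
    fix U assume U: "U \<in> cl (f ` G)"
    then obtain S where S: "S \<in> G" "U = f S" by (auto simp: cl_def)
    then obtain T where T: "T \<in> cl G" "T \<subseteq> S" using ex_cl_subset assms(1) by blast
    have "f T \<in> f ` G" using T by (auto simp: cl_def)
    then have "f T = U" using U S assms(2)[OF T(2)] by (auto simp: cl_def)
    then show "U \<in> f ` cl G" using T by blast
  qed
  show "\<exists>T\<in>cl (f ` G). T \<subseteq> U" if "U \<in> f ` cl G" for U
    using below[of U] that by (auto simp: cl_def)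
  show "S = T" if "S \<in> cl (f ` G)" "T \<in> cl (f ` G)" "S \<subseteq> T" for S T
    using that unfolding cl_def by blast
qed

lemma clutter_minor_trans:
  assumes "clutter_minor G K" "clutter_minor H G"
  shows "clutter_minor H K"
  using assms by induction (auto intro: clutter_minor.intros)

lemma clutter_minor_delete_set:
  assumes "finite D"
  shows "clutter_minor H {S \<in> H. S \<inter> D = {}}"
  using assms
proof induction
  case empty
  then show ?case by (simp add: clutter_minor.refl)
next
  case (insert v D)
  have "{S \<in> H. S \<inter> insert v D = {}} = delete_vertex {S \<in> H. S \<inter> D = {}} v"
    by (auto simp: delete_vertex_def)
  then show ?case using clutter_minor.deletion[OF insert.IH] by simp
qed

lemma clutter_minor_contract_set:
  assumes "clutter H" "finite C"
  shows "clutter_minor H (cl ((\<lambda>S. S - C) ` H))"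
  using assms(2)
proof induction
  case empty
  then show ?case using cl_clutter[OF assms(1)] by (simp add: clutter_minor.refl)
next
  case (insert v C)
  have "finite H" using assms(1) by (simp add: clutter_def set_system_def)
  then have "contract_vertex (cl ((\<lambda>S. S - C) ` H)) v = cl ((\<lambda>S. S - {v}) ` (\<lambda>S. S - C) ` H)"
    unfolding contract_vertex_def by (intro cl_image_cl) auto
  also have "(\<lambda>S. S - {v}) ` (\<lambda>S. S - C) ` H = (\<lambda>S. S - insert v C) ` H"
    unfolding image_image by (intro image_cong) auto
  finally show ?case using clutter_minor.contraction[OF insert.IH, of v] by simp
qed

text \<open>
  The representative \<open>matching n\<close> has the edges \<open>{2 * i, 2 * i + 1}\<close>; an enumeration \<open>e\<close> of the
  given pairs sends the even and the odd end of the \<open>i\<close>-th edge to the two elements of \<open>e i\<close>.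
\<close>

lemma matching_iso:
  assumes "finite I" "\<And>P. P \<in> I \<Longrightarrow> card P = 2"
    and "\<And>P Q. P \<in> I \<Longrightarrow> Q \<in> I \<Longrightarrow> P \<noteq> Q \<Longrightarrow> P \<inter> Q = {}"
  shows "clutter_iso (matching (card I)) I"
proof -
  obtain e where e: "bij_betw e {..<card I} I"
    using ex_bij_betw_nat_finite[OF assms(1)] unfolding atLeast0LessThan by blast
  have "\<exists>a b. e i = {a, b} \<and> a \<noteq> b" if "i < card I" for i
    using assms(2)[of "e i"] e that by (auto simp: bij_betw_def card_2_iff)
  then obtain a b where ab: "\<And>i. i < card I \<Longrightarrow> e i = {a i, b i} \<and> a i \<noteq> b i" by metis
  define f where "f n = (if even n then a (n div 2) else b (n div 2))" for n
  have f2: "f (2 * i) = a i" "f (Suc (2 * i)) = b i" for i by (auto simp: f_def)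
  have fe: "f ` {2 * i, 2 * i + 1} = e i" if "i < card I" for i
    using ab[OF that] by (simp add: f2)
  have img: "(\<lambda>S. f ` S) ` matching (card I) = I"
  proof -
    have "(\<lambda>S. f ` S) ` matching (card I) = e ` {..<card I}"
      unfolding matching_def image_image using fe by (intro image_cong) auto
    then show ?thesis using e by (simp add: bij_betw_def)
  qed
  have V: "n div 2 < card I" "f n \<in> e (n div 2)" if "n \<in> vertex_set (matching (card I))" for n
    using that ab by (auto simp: vertex_set_def matching_def f2)
  have "inj_on f (vertex_set (matching (card I)))"
  proof (rule inj_onI)
    fix m n assume m: "m \<in> vertex_set (matching (card I))"
      and n: "n \<in> vertex_set (matching (card I))" and eq: "f m = f n"
    have "e (m div 2) = e (n div 2)"
      using V[OF m] V[OF n] eq e assms(3) by (metis bij_betwE disjoint_iff lessThan_iff)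
    then have d: "m div 2 = n div 2"
      using V[OF m] V[OF n] e by (auto simp: bij_betw_def inj_on_def)
    then have "even m = even n"
      using eq ab[OF V(1)[OF m]] unfolding f_def by (metis (full_types))
    then show "m = n" using d by (metis even_two_times_div_two odd_two_times_div_two_succ)
  qed
  moreover have "f ` vertex_set (matching (card I)) = vertex_set I"
    using image_Union[of f "matching (card I)"] unfolding vertex_set_def img .
  ultimately show ?thesis unfolding clutter_iso_def bij_betw_def using img by blast
qed

text \<open>
  Delete all vertices outside \<open>C\<close> and \<open>\<Union>K\<close>, and contract \<open>C\<close>. By \<open>edge\<close> each \<open>P\<close> in \<open>K\<close> is
  then the trace of some edge, and by \<open>cover\<close> every other trace contains a member of \<open>K\<close>, so
  that it is dropped by \<open>cl\<close>.
\<close>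

lemma matching_minor_of_pairs:
  assumes H: "clutter H" and "finite C" "finite K"
    and pair: "\<And>P. P \<in> K \<Longrightarrow> card P = 2"
    and disj: "\<And>P Q. P \<in> K \<Longrightarrow> Q \<in> K \<Longrightarrow> P \<noteq> Q \<Longrightarrow> P \<inter> Q = {}"
    and CK: "C \<inter> \<Union>K = {}"
    and edge: "\<And>P. P \<in> K \<Longrightarrow> \<exists>S\<in>H. P \<subseteq> S \<and> S \<subseteq> P \<union> C"
    and cover: "\<And>R. R \<in> H \<Longrightarrow> R \<subseteq> C \<union> \<Union>K \<Longrightarrow> \<exists>P\<in>K. P \<subseteq> R"
  shows "\<exists>G. clutter_minor H G \<and> clutter_iso (matching (card K)) G"
proof -
  define H1 where "H1 = {S \<in> H. S \<inter> (\<Union>H - (C \<union> \<Union>K)) = {}}"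
  have H1: "S \<in> H1 \<longleftrightarrow> S \<in> H \<and> S \<subseteq> C \<union> \<Union>K" for S unfolding H1_def by auto
  have "finite (\<Union>H)" using H unfolding clutter_def set_system_def by blast
  then have "clutter_minor H H1" unfolding H1_def by (intro clutter_minor_delete_set) simp
  moreover have "clutter H1" using H unfolding clutter_def set_system_def H1_def by simp
  then have "clutter_minor H1 (cl ((\<lambda>S. S - C) ` H1))"
    using \<open>finite C\<close> by (rule clutter_minor_contract_set)
  moreover have "cl ((\<lambda>S. S - C) ` H1) = K"
  proof (rule cl_eqI)
    show "K \<subseteq> (\<lambda>S. S - C) ` H1"
    proof
      fix P assume P: "P \<in> K"
      then obtain S where S: "S \<in> H" "P \<subseteq> S" "S \<subseteq> P \<union> C" using edge by blast
      have "S \<in> H1" using S P unfolding H1 by blast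
      moreover have "S - C = P" using S P CK by blast
      ultimately show "P \<in> (\<lambda>S. S - C) ` H1" by blast
    qed
    show "\<exists>P\<in>K. P \<subseteq> R" if R: "R \<in> (\<lambda>S. S - C) ` H1" for R
    proof -
      obtain S where S: "S \<in> H" "S \<subseteq> C \<union> \<Union>K" "R = S - C" using R H1 by blast
      obtain P where P: "P \<in> K" "P \<subseteq> S" using cover[OF S(1,2)] by blast
      then have "P \<subseteq> R" using CK S(3) by blast
      then show ?thesis using P by blast
    qed
    show "P = Q" if "P \<in> K" "Q \<in> K" "P \<subseteq> Q" for P Q
    proof (rule ccontr)
      assume "P \<noteq> Q"
      then have "P = {}" using disj[of P Q] that by blast
      then show False using pair[of P] that by simp
    qed
  qed
  ultimately have "clutter_minor H K" using clutter_minor_trans by metis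
  moreover have "clutter_iso (matching (card K)) K" using \<open>finite K\<close> pair disj by (rule matching_iso)
  ultimately show ?thesis by blast
qed

section \<open>Long certificates contain matchings\<close>

lemma certificate_finite: "certificate F X M \<Longrightarrow> finite M"
  by (induction rule: certificate.induct) simp_all

text \<open>
  A proportion of at least \<open>1 / ((2 * r - 3) * 2 ^ (r - 2))\<close> of the recorded pairs can be
  turned into a matching minor: the power of two pays for choosing one vertex from every pair
  so that the chosen vertices contain what the edge under consideration has in other pairs, and
  \<open>2 * r - 3 = 2 * (r - 2) + 1\<close> pays for edges that avoid each other's pairs.
\<close>

lemma large_certificate_gives_matching_minor:
  assumes H: "clutter H" and rank: "\<And>S. S \<in> H \<Longrightarrow> card S \<le> r"
    and M: "certificate H {} M" and large: "k * (2 * r - 3) * 2 ^ (r - 2) < card M"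
  shows "\<exists>G. clutter_minor H G \<and> clutter_iso (matching (k + 1)) G"
proof -
  have finM: "finite M" using M by (rule certificate_finite)
  have pr: "fst j \<in> H" "snd j \<subseteq> fst j" "card (snd j) = 2" if "j \<in> M" for j
    using certificate_pair[OF M, of "fst j" "snd j"] that by simp_all
  have disj: "snd i \<inter> snd j = {}" "\<not> snd j \<subseteq> fst i" if "i \<in> M" "j \<in> M" "i \<noteq> j" for i j
    using certificate_disjoint_pairs[OF M, of "fst i" "snd i" "fst j" "snd j"] that by simp_all
  have finH: "finite S" if "S \<in> H" for S
    using H that unfolding clutter_def set_system_def by blast
  define d where "d = r - 2"
  have "M \<noteq> {}" using large by auto
  then obtain j0 where "j0 \<in> M" by blast
  then have "2 \<le> r"
    using pr[of j0] rank[of "fst j0"] finH[of "fst j0"] card_mono[of "fst j0" "snd j0"] by linarith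
  then have r: "2 * r - 3 = 2 * d + 1" "r = d + 2" by (simp_all add: d_def)

  have "\<exists>a b. snd j = {a, b} \<and> a \<noteq> b" if "j \<in> M" for j
    using pr(3)[OF that] by (auto simp: card_2_iff)
  then obtain a b where ab: "\<And>j. j \<in> M \<Longrightarrow> snd j = {a j, b j}" "\<And>j. j \<in> M \<Longrightarrow> a j \<noteq> b j"
    by metis
  \<comment> \<open>\<open>N i\<close> collects the other pairs met by the edge of \<open>i\<close>. As that edge contains none
      of these pairs entirely, it meets each in one vertex, and \<open>Y i\<close> says which one.\<close>
  define N where "N i = {j \<in> M. j \<noteq> i \<and> fst i \<inter> snd j \<noteq> {}}" for i
  define Y where "Y i = {j \<in> N i. a j \<in> fst i}" for i
  have cardN: "card (N i) \<le> d" if i: "i \<in> M" for i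
  proof -
    have "\<forall>j\<in>N i. \<exists>w. w \<in> fst i \<inter> snd j" by (auto simp: N_def)
    then obtain w where w: "\<And>j. j \<in> N i \<Longrightarrow> w j \<in> fst i \<inter> snd j" by metis
    have "inj_on w (N i)"
    proof (rule inj_onI, rule ccontr)
      fix j l assume jl: "j \<in> N i" "l \<in> N i" "w j = w l" "j \<noteq> l"
      then have "snd j \<inter> snd l = {}" by (intro disj) (auto simp: N_def)
      then show False using w[OF jl(1)] w[OF jl(2)] jl(3) by auto
    qed
    moreover have "w ` N i \<subseteq> fst i - snd i"
    proof
      fix x assume "x \<in> w ` N i"
      then obtain j where j: "j \<in> N i" "x = w j" by blast
      then have "snd i \<inter> snd j = {}" using i by (intro disj) (auto simp: N_def)
      then show "x \<in> fst i - snd i" using w[OF j(1)] j(2) by auto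
    qed
    ultimately have "card (N i) \<le> card (fst i - snd i)"
      using finH[OF pr(1)[OF i]] by (intro card_inj_on_le) auto
    also have "\<dots> = card (fst i) - 2"
      using pr[OF i] finH[OF pr(1)[OF i]] by (simp add: card_Diff_subset finite_subset)
    also have "\<dots> \<le> d" using rank[OF pr(1)[OF i]] by (simp add: d_def)
    finally show ?thesis .
  qed
  have "\<exists>Z\<subseteq>M. card M \<le> 2 ^ d * card {i \<in> M. Z \<inter> N i = Y i}"
    by (rule ex_subset_agreeing_with_many) (use finM cardN in \<open>auto simp: N_def Y_def\<close>)
  then obtain Z where Z: "card M \<le> 2 ^ d * card {i \<in> M. Z \<inter> N i = Y i}" by blast
  \<comment> \<open>The vertex \<open>c j\<close> of the pair of \<open>j\<close> is chosen for contraction; \<open>G\<close> collects the entries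
      whose edges meet all other pairs in chosen vertices only.\<close>
  define G where "G = {i \<in> M. Z \<inter> N i = Y i}"
  define c where "c j = (if j \<in> Z then a j else b j)" for j
  have c: "c j \<in> snd j" if "j \<in> M" for j using ab[OF that] by (auto simp: c_def)
  have good: "fst i \<inter> snd j \<subseteq> {c j}" if i: "i \<in> G" and j: "j \<in> M" "j \<noteq> i" for i j
  proof (cases "j \<in> N i")
    case True
    have "j \<in> Z \<longleftrightarrow> a j \<in> fst i" using i True unfolding G_def Y_def by blast
    moreover have "\<not> snd j \<subseteq> fst i" using disj(2)[of i j] i j by (auto simp: G_def)
    ultimately show ?thesis using ab[OF j(1)] by (auto simp: c_def)
  next
    case False
    then show ?thesis using j by (auto simp: N_def)
  qed
  have "card {j \<in> G. (i, j) \<in> {(i, j). j \<in> N i}} \<le> d" if "i \<in> G" for i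
  proof -
    have "finite (N i)" using finM by (simp add: N_def)
    then have "card {j \<in> G. (i, j) \<in> {(i, j). j \<in> N i}} \<le> card (N i)"
      by (intro card_mono) auto
    then show ?thesis using cardN[of i] that by (simp add: G_def)
  qed
  moreover have "finite G" using finM by (simp add: G_def)
  ultimately obtain J where J: "J \<subseteq> G" "card G \<le> (2 * d + 1) * card J"
    and ind: "\<forall>i\<in>J. \<forall>j\<in>J. i \<noteq> j \<longrightarrow> (i, j) \<notin> {(i, j). j \<in> N i}"
    using ex_independent_set[of G "{(i, j). j \<in> N i}" d] by blast
  have ind': "j \<notin> N i" if "i \<in> J" "j \<in> J" "i \<noteq> j" for i j using ind that by simp
  have "card M \<le> 2 ^ d * card G" using Z by (simp add: G_def)
  also have "\<dots> \<le> 2 ^ d * ((2 * d + 1) * card J)" using J(2) by (rule mult_le_mono2)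
  finally have "k * ((2 * d + 1) * 2 ^ d) < card J * ((2 * d + 1) * 2 ^ d)"
    using large unfolding r(1) d_def[symmetric] by (simp only: mult_ac)
  then have "k < card J" using mult_less_cancel2 by blast
  then obtain L where L: "L \<subseteq> J" "card L = k + 1" "finite L"
    using obtain_subset_with_card_n[of "k + 1" J] by auto
  have LM: "j \<in> M" "j \<in> G" if "j \<in> L" for j using that L J by (auto simp: G_def)

  \<comment> \<open>The pairs of \<open>L\<close> are left alone. Exactly one vertex of every other pair is contracted, so
      that no edge contained in \<open>C \<union> \<Union>(snd ` L)\<close> includes such a pair.\<close>
  define C where "C = (\<Union>(fst ` M) - \<Union>(snd ` M)) \<union> c ` (M - L)"
  have "finite C" using finM finH pr(1) unfolding C_def by auto
  have CL: "C \<inter> snd i = {}" if "i \<in> L" for i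
  proof -
    have "c j \<notin> snd i" if "j \<in> M - L" for j
      using disj(1)[of i j] c[of j] LM[OF \<open>i \<in> L\<close>] \<open>i \<in> L\<close> that by blast
    then show ?thesis using LM[OF that] unfolding C_def by blast
  qed
  have injL: "inj_on snd L"
  proof (rule inj_onI, rule ccontr)
    fix i j assume ij: "i \<in> L" "j \<in> L" "snd i = snd j" "i \<noteq> j"
    then have "snd i = {}" using disj(1)[of i j] LM by auto
    then show False using pr(3)[of i] LM(1)[OF ij(1)] by simp
  qed
  have "\<exists>G. clutter_minor H G \<and> clutter_iso (matching (card (snd ` L))) G"
  proof (rule matching_minor_of_pairs[OF H \<open>finite C\<close>])
    show "finite (snd ` L)" using L by simp
    show "card P = 2" if "P \<in> snd ` L" for P using that pr(3) LM by auto
    show "P \<inter> Q = {}" if PQ: "P \<in> snd ` L" "Q \<in> snd ` L" "P \<noteq> Q" for P Q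
    proof -
      obtain i j where "i \<in> L" "j \<in> L" "P = snd i" "Q = snd j" using PQ by blast
      then show ?thesis using disj(1)[of i j] LM PQ(3) by auto
    qed
    show "C \<inter> \<Union>(snd ` L) = {}" using CL by blast
    show "\<exists>S\<in>H. P \<subseteq> S \<and> S \<subseteq> P \<union> C" if P: "P \<in> snd ` L" for P
    proof -
      obtain i where i: "i \<in> L" "P = snd i" using P by blast
      have "x \<in> P \<union> C" if x: "x \<in> fst i" for x
      proof (cases "x \<in> \<Union>(snd ` M)")
        case True
        then obtain j where j: "j \<in> M" "x \<in> snd j" by blast
        show ?thesis
        proof (cases "j = i")
          case False
          then have "j \<in> N i" using j x by (auto simp: N_def)
          then have "j \<notin> L" using ind'[of i j] i(1) L(1) False by blast
          moreover have "x = c j" using good[OF LM(2)[OF i(1)] j(1) False] x j(2) by auto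
          ultimately show ?thesis using j(1) by (auto simp: C_def)
        qed (use i j in simp)
      next
        case False
        then show ?thesis using x LM(1)[OF i(1)] by (auto simp: C_def)
      qed
      then show ?thesis using pr(1,2)[OF LM(1)[OF i(1)]] i(2) by blast
    qed
    show "\<exists>P\<in>snd ` L. P \<subseteq> R" if R: "R \<in> H" "R \<subseteq> C \<union> \<Union>(snd ` L)" for R
    proof -
      have sub: "x \<in> \<Union>(fst ` M)" if "j \<in> M" "x \<in> snd j" for j x
        using pr(2)[OF that(1)] that by blast
      have "C \<subseteq> \<Union>(fst ` M)" using sub[OF _ c] unfolding C_def by blast
      moreover have "\<Union>(snd ` L) \<subseteq> \<Union>(fst ` M)" using sub LM(1) by blast
      ultimately have "R \<subseteq> {} \<union> \<Union>(fst ` M)"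
        unfolding Un_empty_left using R(2) by (meson Un_least subset_trans)
      then obtain j where j: "j \<in> M" "snd j \<subseteq> R"
        using certificate_covers[OF M R(1)] by blast
      have "j \<in> L"
      proof (rule ccontr)
        assume jL: "j \<notin> L"
        have only: "x = c j" if x: "x \<in> snd j" for x
        proof -
          have "x \<notin> snd l" if "l \<in> L" for l
            using disj(1)[OF j(1) LM(1)[OF that]] jL that x by blast
          then have "x \<notin> \<Union>(snd ` L)" by simp
          then have "x \<in> C" using x j(2) R(2) by (meson UnE subsetD)
          moreover have "x \<in> \<Union>(snd ` M)" using x j(1) by blast
          ultimately have "x \<in> c ` (M - L)" unfolding C_def Un_iff Diff_iff by blast
          then obtain l where l: "l \<in> M - L" "x = c l" by blast
          then have "l = j" using disj(1)[OF j(1), of l] c[of l] x by auto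
          then show ?thesis using l by simp
        qed
        show False using only[of "a j"] only[of "b j"] ab[OF j(1)] by simp
      qed
      then show ?thesis using j(2) by blast
    qed
  qed
  then show ?thesis using L(2) card_image[OF injL] by simp
qed

section \<open>Counting certificates\<close>

text \<open>
  Distinct entries of a certificate have distinct edges, since an edge contains no pair but its
  own. A certificate of size \<open>m\<close> is thus the graph of a function that assigns a pair to each
  of \<open>m\<close> edges.
\<close>

lemma card_blocker_le:
  assumes F: "set_system F" and rank: "\<And>S. S \<in> F \<Longrightarrow> card S \<le> r"
    and short: "\<And>M. certificate F {} M \<Longrightarrow> card M \<le> n"
  shows "card (blocker F) \<le> (\<Sum>m = 0..n. (card F choose m) * (r choose 2) ^ m)"
proof -
  have fin: "finite F" "\<And>S. S \<in> F \<Longrightarrow> finite S" using F unfolding set_system_def by blast+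
  define pairs where "pairs S = {P. P \<subseteq> S \<and> card P = 2}" for S :: "nat set"
  define Sub where "Sub m = {A. A \<subseteq> F \<and> card A = m}" for m
  define Cert where "Cert m = (\<Union>A\<in>Sub m. (\<lambda>g. (\<lambda>S. (S, g S)) ` A) ` (PiE A pairs))" for m
  have finA: "finite A" if "A \<in> Sub m" for A m using that fin(1) by (auto simp: Sub_def intro: finite_subset)
  have finSub: "finite (Sub m)" for m using fin(1) by (simp add: Sub_def)
  have finpairs: "finite (pairs S)" if "S \<in> F" for S
    unfolding pairs_def using fin(2)[OF that] by simp
  have finPi: "finite (PiE A pairs)" if "A \<in> Sub m" for A m
    using finA[OF that] that finpairs by (intro finite_PiE) (auto simp: Sub_def)
  have cardPi: "card (PiE A pairs) \<le> (r choose 2) ^ m" if A: "A \<in> Sub m" for A m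
  proof -
    have "card (PiE A pairs) = (\<Prod>S\<in>A. card (pairs S))" using finA[OF A] by (rule card_PiE)
    also have "\<dots> \<le> (\<Prod>S\<in>A. r choose 2)"
    proof (rule prod_mono)
      fix S assume "S \<in> A"
      then have "S \<in> F" using A by (auto simp: Sub_def)
      then have "card (pairs S) = card S choose 2" unfolding pairs_def by (intro n_subsets fin)
      also have "\<dots> \<le> r choose 2" using rank[OF \<open>S \<in> F\<close>] by (rule binomial_right_mono)
      finally show "0 \<le> card (pairs S) \<and> card (pairs S) \<le> r choose 2" by simp
    qed
    also have "\<dots> = (r choose 2) ^ m" using A by (simp add: Sub_def)
    finally show ?thesis .
  qed
  have finCert: "finite (Cert m)" for m unfolding Cert_def using finSub finPi by blast
  have cardCert: "card (Cert m) \<le> (card F choose m) * (r choose 2) ^ m" for m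
  proof -
    have "card (Cert m) \<le> (\<Sum>A\<in>Sub m. card ((\<lambda>g. (\<lambda>S. (S, g S)) ` A) ` (PiE A pairs)))"
      unfolding Cert_def by (rule card_UN_le) (rule finSub)
    also have "\<dots> \<le> (\<Sum>A\<in>Sub m. (r choose 2) ^ m)"
      using card_image_le[OF finPi] cardPi by (intro sum_mono) (blast intro: order_trans)
    also have "\<dots> = (card F choose m) * (r choose 2) ^ m"
      using n_subsets[OF fin(1)] by (simp add: Sub_def)
    finally show ?thesis .
  qed
  have sub: "{M. certificate F {} M} \<subseteq> (\<Union>m\<in>{0..n}. Cert m)"
  proof
    fix M assume "M \<in> {M. certificate F {} M}"
    then have M: "certificate F {} M" by simp
    have pr: "fst j \<in> F" "snd j \<in> pairs (fst j)" if "j \<in> M" for j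
      using certificate_pair[OF M, of "fst j" "snd j"] that by (simp_all add: pairs_def)
    have inj: "inj_on fst M"
    proof (rule inj_onI, rule ccontr)
      fix i j assume ij: "i \<in> M" "j \<in> M" "fst i = fst j" "i \<noteq> j"
      have "(fst i, snd i) \<in> M" "(fst j, snd j) \<in> M" "(fst i, snd i) \<noteq> (fst j, snd j)"
        using ij(1,2,4) by simp_all
      then have "\<not> snd j \<subseteq> fst i" using certificate_disjoint_pairs[OF M] by blast
      then show False using pr(2)[OF ij(2)] ij(3) by (simp add: pairs_def)
    qed
    define A where "A = fst ` M"
    define g where "g = (\<lambda>S\<in>A. snd (the_inv_into M fst S))"
    have g: "g (fst j) = snd j" if "j \<in> M" for j
      using that inj by (simp add: g_def A_def the_inv_into_f_f)
    have "A \<in> Sub (card M)" using pr(1) card_image[OF inj] by (auto simp: Sub_def A_def)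
    moreover have "g \<in> PiE A pairs"
    proof (rule PiE_I)
      show "g S \<in> pairs S" if "S \<in> A" for S using that g pr(2) by (auto simp: A_def)
    qed (simp add: g_def)
    moreover have "M = (\<lambda>S. (S, g S)) ` A" using g by (force simp: A_def)
    ultimately have "M \<in> Cert (card M)" unfolding Cert_def by blast
    then show "M \<in> (\<Union>m\<in>{0..n}. Cert m)" using short[OF M] by auto
  qed
  obtain f where f: "inj_on f (blocker F)" "f ` blocker F \<subseteq> {M. certificate F {} M}"
    using blocker_certificate_injection[OF F, of "{}"] by auto
  have "card (blocker F) \<le> card (\<Union>m\<in>{0..n}. Cert m)"
    using f(1) order_trans[OF f(2) sub] finCert by (intro card_inj_on_le) auto
  also have "\<dots> \<le> (\<Sum>m = 0..n. card (Cert m))" by (rule card_UN_le) simp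
  also have "\<dots> \<le> (\<Sum>m = 0..n. (card F choose m) * (r choose 2) ^ m)"
    by (rule sum_mono) (rule cardCert)
  finally show ?thesis .
qed

section \<open>The bound\<close>

theorem theorem1p5:
  fixes k r :: nat and H :: "nat set set"
  assumes "clutter H"
    and "clutter_rank H = r"
    and "minor_free (matching (k + 1)) H"
  shows "card (blocker H) \<le>
    (\<Sum>m = 0..k * (2 * r - 3) * 2 ^ (r - 2). (card H choose m) * (r choose 2) ^ m)"
proof (rule card_blocker_le)
  show "set_system H" using assms(1) by (simp add: clutter_def)
  then show rank: "card S \<le> r" if "S \<in> H" for S
    using that assms(2) by (auto simp: clutter_rank_def set_system_def)
  show "card M \<le> k * (2 * r - 3) * 2 ^ (r - 2)" if "certificate H {} M" for M
    using large_certificate_gives_matching_minor[OF assms(1) rank that, of k] assms(3)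
    unfolding minor_free_def by (meson not_le)
qed

end
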